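(* Let $\mathbb{K}$ be a field of characteristic $0$, let $f\in R_n=\mathbb{K}[x_1,\dots,x_n]$ be a non-zero polynomial with Bernstein-Sato polynomial $b_f(s)$, and let $\alpha\in\mathbb{Q}_{>0}$. Let $m_\alpha$ be the multiplicity of $\alpha$ as a root of $b_f(-s)$ (with $m_\alpha=0$ if $\alpha$ is not a root), consider the left ideal $I=\operatorname{Ann}_{D_n[s]}(f^s)+D_n[s]\langle f\rangle$ of $D_n[s]$, and let $i\ge 0$ be an integer. The following conditions are equivalent: (1) $m_\alpha>i$; (2) $\big(I:(s+\alpha)^i\big)+D_n[s]\langle s+\alpha\rangle\neq D_n[s]$; (3) $\big(I:(s+\alpha)^i\big)|_{s=-\alpha}\neq D_n$.
   Context: $D_n$ is the $n$-th Weyl algebra, generated over $\mathbb{K}$ by $x_1,\dots,x_n,\partial_1,\dots,\partial_n$ with relations $\partial_i x_j=x_j\partial_i+\delta_{ij}$, $x_jx_i=x_ix_j$, $\partial_j\partial_i=\partial_i\partial_j$; $D_n[s]=D_n\otimes_{\mathbb{K}}\mathbb{K}[s]$ (so $s$ is central). $D_n[s]\langle\dots\rangle$ denotes the left ideal generated by the listed elements. For a left ideal $I\subseteq D_n[s]$ and $q\in\mathbb{K}[s]$, $I:q=\{P\in D_n[s]\mid qP\in I\}$; and $I|_{s=-\alpha}=\{P(-\alpha)\mid P(s)\in I\}\subseteq D_n$ is the left ideal obtained by substituting $s=-\alpha$. $M=R_n[s,\frac1f]\cdot f^s$ is the free $R_n[s,\frac1f]$-module of rank one generated by the symbol $f^s$,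 a left $D_n[s]$-module via $\partial_i(g\cdot f^s)=\big(\frac{\partial g}{\partial x_i}+s\,g\,\frac{\partial f}{\partial x_i}\frac1f\big)\cdot f^s$. $\operatorname{Ann}_{D_n[s]}(f^s)$ is the left ideal of all $P(s)\in D_n[s]$ with $P(s)\cdot f^s=0$. The Bernstein-Sato polynomial $b_f(s)\in\mathbb{K}[s]$ is the monic polynomial of minimal degree for which there is $P(s)\in D_n[s]$ with $P(s)f\cdot f^s=b_f(s)\cdot f^s$ in $M$; equivalently $\langle b_f(s)\rangle=(\operatorname{Ann}_{D_n[s]}(f^s)+D_n[s]\langle f\rangle)\cap\mathbb{K}[s]$. *)

theory Defs
  imports
    "HOL-Library.Poly_Mapping"
    "HOL-Library.Set_Algebras"
    "HOL-Computational_Algebra.Computational_Algebra"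
begin

section \<open>Ideals in noncommutative rings\<close>

inductive_set two_sided_ideal :: "'a::ring_1 set \<Rightarrow> 'a set" for S where
  gen: "x \<in> S \<Longrightarrow> x \<in> two_sided_ideal S"
| zero: "0 \<in> two_sided_ideal S"
| add: "x \<in> two_sided_ideal S \<Longrightarrow> y \<in> two_sided_ideal S \<Longrightarrow> x + y \<in> two_sided_ideal S"
| lmult: "x \<in> two_sided_ideal S \<Longrightarrow> r * x \<in> two_sided_ideal S"
| rmult: "x \<in> two_sided_ideal S \<Longrightarrow> x * r \<in> two_sided_ideal S"

inductive_set left_ideal :: "'a::ring_1 set \<Rightarrow> 'a set" for S where
  gen: "x \<in> S \<Longrightarrow> x \<in> left_ideal S"
| zero: "0 \<in> left_ideal S"
| add: "x \<in> left_ideal S \<Longrightarrow> y \<in> left_ideal S \<Longrightarrow> x + y \<in> left_ideal S"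
| lmult: "x \<in> left_ideal S \<Longrightarrow> r * x \<in> left_ideal S"

definition ideal_quotient :: "'a::ring_1 set \<Rightarrow> 'a \<Rightarrow> 'a set" where
  "ideal_quotient I q = {P. q * P \<in> I}"


section \<open>The polynomial ring and its partial derivatives\<close>

text \<open>
  The variables are indexed by a finite type \<open>'n\<close>, so that \<open>n = CARD('n)\<close>.  The linear
  order on \<open>'n\<close> carries no content: it gives access to the library instance making
  polynomials an integral domain, and fixes an order for writing monomials as words.
\<close>

type_synonym ('n, 'k) mpol = "('n \<Rightarrow>\<^sub>0 nat) \<Rightarrow>\<^sub>0 'k"

definition mvar :: "'n \<Rightarrow> ('n, 'k::field) mpol" where
  "mvar i = Poly_Mapping.single (Poly_Mapping.single i 1) 1"

definition pdiff :: "'n \<Rightarrow> ('n, 'k::field) mpol \<Rightarrow> ('n, 'k) mpol" where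
  "pdiff i p = (\<Sum>m\<in>Poly_Mapping.keys p.
     Poly_Mapping.single (m - Poly_Mapping.single i 1)
       (of_nat (Poly_Mapping.lookup m i) * Poly_Mapping.lookup p m))"

lemma pm_sum_single: "p = (\<Sum>m\<in>Poly_Mapping.keys p. Poly_Mapping.single m (Poly_Mapping.lookup p m))"
proof (rule poly_mapping_eqI)
  fix k
  have "Poly_Mapping.lookup (\<Sum>m\<in>Poly_Mapping.keys p. Poly_Mapping.single m (Poly_Mapping.lookup p m)) k
      = (\<Sum>m\<in>Poly_Mapping.keys p. (Poly_Mapping.lookup p m when m = k))"
    by (simp add: lookup_sum lookup_single)
  also have "\<dots> = Poly_Mapping.lookup p k"
    by (simp add: when_def in_keys_iff)
  finally show "Poly_Mapping.lookup p k =
    Poly_Mapping.lookup (\<Sum>m\<in>Poly_Mapping.keys p. Poly_Mapping.single m (Poly_Mapping.lookup p m)) k" by simp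
qed

lemma pm_induct [case_names zero add_single]:
  assumes "P 0" and "\<And>m c p. P p \<Longrightarrow> P (Poly_Mapping.single m c + p)"
  shows "P (p :: 'a \<Rightarrow>\<^sub>0 'b::comm_monoid_add)"
proof -
  have "P (\<Sum>m\<in>A. Poly_Mapping.single m (g m))" if "finite A" for A :: "'a set" and g
    using that by (induction A rule: finite_induct) (auto intro: assms)
  then show ?thesis using pm_sum_single[of p] by (metis finite_keys)
qed

lemma keys_sum_superset:
  assumes "finite A" "Poly_Mapping.keys p \<subseteq> A" "\<And>m. g m 0 = 0"
  shows "(\<Sum>m\<in>Poly_Mapping.keys p. g m (Poly_Mapping.lookup p m)) = (\<Sum>m\<in>A. g m (Poly_Mapping.lookup p m))"
  by (rule sum.mono_neutral_left) (use assms in \<open>auto simp: in_keys_iff\<close>)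

lemma keys_sum_add:
  fixes g :: "'a \<Rightarrow> 'b::comm_monoid_add \<Rightarrow> 'c::comm_monoid_add"
  assumes "\<And>m. g m 0 = 0" "\<And>m a b. g m (a + b) = g m a + g m b"
  shows "(\<Sum>m\<in>Poly_Mapping.keys (p + q). g m (Poly_Mapping.lookup (p + q) m)) =
     (\<Sum>m\<in>Poly_Mapping.keys p. g m (Poly_Mapping.lookup p m)) +
     (\<Sum>m\<in>Poly_Mapping.keys q. g m (Poly_Mapping.lookup q m))"
proof -
  let ?A = "Poly_Mapping.keys p \<union> Poly_Mapping.keys q"
  have "(\<Sum>m\<in>Poly_Mapping.keys (p + q). g m (Poly_Mapping.lookup (p + q) m))
      = (\<Sum>m\<in>?A. g m (Poly_Mapping.lookup (p + q) m))"
    by (rule keys_sum_superset) (auto simp: assms Poly_Mapping.keys_add)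
  also have "\<dots> = (\<Sum>m\<in>?A. g m (Poly_Mapping.lookup p m)) + (\<Sum>m\<in>?A. g m (Poly_Mapping.lookup q m))"
    by (simp add: lookup_add assms sum.distrib)
  also have "(\<Sum>m\<in>?A. g m (Poly_Mapping.lookup p m)) = (\<Sum>m\<in>Poly_Mapping.keys p. g m (Poly_Mapping.lookup p m))"
    by (rule keys_sum_superset[symmetric]) (auto simp: assms)
  also have "(\<Sum>m\<in>?A. g m (Poly_Mapping.lookup q m)) = (\<Sum>m\<in>Poly_Mapping.keys q. g m (Poly_Mapping.lookup q m))"
    by (rule keys_sum_superset[symmetric]) (auto simp: assms)
  finally show ?thesis .
qed

lemma pdiff_0 [simp]: "pdiff i 0 = 0"
  by (simp add: pdiff_def)

lemma pdiff_add: "pdiff i (p + q) = pdiff i p + pdiff i q"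
  unfolding pdiff_def
  by (rule keys_sum_add[where g = "\<lambda>m c. Poly_Mapping.single (m - Poly_Mapping.single i 1) (of_nat (Poly_Mapping.lookup m i) * c)"])
     (auto simp: single_add algebra_simps)

lemma pdiff_single: "pdiff i (Poly_Mapping.single m c) =
    Poly_Mapping.single (m - Poly_Mapping.single i 1) (of_nat (Poly_Mapping.lookup m i) * c)"
  by (simp add: pdiff_def)

lemma single_exp_shift:
  fixes a b :: "'n \<Rightarrow>\<^sub>0 nat"
  assumes "Poly_Mapping.lookup a i > 0"
  shows "a - Poly_Mapping.single i 1 + b = a + b - Poly_Mapping.single i 1"
proof (rule poly_mapping_eqI)
  fix k show "Poly_Mapping.lookup (a - Poly_Mapping.single i 1 + b) k = Poly_Mapping.lookup (a + b - Poly_Mapping.single i 1) k"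
    using assms by (cases "k = i") (simp_all add: lookup_add lookup_minus lookup_single)
qed

lemma pdiff_mult_single:
  "pdiff i (Poly_Mapping.single a c * Poly_Mapping.single b d) =
   pdiff i (Poly_Mapping.single a c) * Poly_Mapping.single b d + Poly_Mapping.single a c * pdiff i (Poly_Mapping.single b d)"
proof -
  let ?e = "Poly_Mapping.single i (1::nat)"
  have 1: "pdiff i (Poly_Mapping.single a c) * Poly_Mapping.single b d =
     Poly_Mapping.single (a + b - ?e) (of_nat (Poly_Mapping.lookup a i) * c * d)"
    by (cases "Poly_Mapping.lookup a i = 0") (simp_all add: pdiff_single mult_single single_exp_shift[simplified])
  have 2: "Poly_Mapping.single a c * pdiff i (Poly_Mapping.single b d) =
     Poly_Mapping.single (a + b - ?e) (of_nat (Poly_Mapping.lookup b i) * c * d)"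
    using single_exp_shift[of b i a]
    by (cases "Poly_Mapping.lookup b i = 0") (simp_all add: pdiff_single mult_single add.commute mult_ac)
  show ?thesis
    unfolding 1 2 by (simp add: pdiff_single mult_single lookup_add single_add[symmetric] algebra_simps)
qed

lemma pdiff_mult: "pdiff i (p * q) = pdiff i p * q + p * pdiff i q"
proof (induction p rule: pm_induct)
  case (add_single m c p)
  have "pdiff i (Poly_Mapping.single m c * q) = pdiff i (Poly_Mapping.single m c) * q + Poly_Mapping.single m c * pdiff i q"
  proof (induction q rule: pm_induct)
    case (add_single m' c' q)
    then show ?case by (simp add: distrib_left pdiff_add pdiff_mult_single algebra_simps)
  qed simp
  with add_single show ?case by (simp add: distrib_right pdiff_add algebra_simps)
qed simp

lemma pdiff_commute: "pdiff i (pdiff j p) = pdiff j (pdiff i p)"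
proof (induction p rule: pm_induct)
  case (add_single m c p)
  have "m - Poly_Mapping.single j 1 - Poly_Mapping.single i 1 = m - Poly_Mapping.single i 1 - Poly_Mapping.single j (1::nat)"
    by (rule poly_mapping_eqI) (simp add: lookup_minus)
  then have "pdiff i (pdiff j (Poly_Mapping.single m c)) = pdiff j (pdiff i (Poly_Mapping.single m c))"
    by (cases "i = j") (simp_all add: pdiff_single lookup_minus lookup_single mult_ac)
  with add_single show ?case by (simp add: pdiff_add)
qed simp

lemma pdiff_const: "pdiff i (Poly_Mapping.single 0 c) = 0"
  by (simp add: pdiff_single)

lemma pdiff_mvar: "pdiff i (mvar j) = (if i = j then 1 else 0)"
proof (cases "i = j")
  case True
  have "Poly_Mapping.single j 1 - Poly_Mapping.single j (1::nat) = 0"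
    by (rule poly_mapping_eqI) (simp add: lookup_minus)
  then show ?thesis using True by (simp add: mvar_def pdiff_single)
qed (simp add: mvar_def pdiff_single lookup_single)


section \<open>Rational functions in the variables and $s$\<close>

text \<open>
  $R_n[s]$ is a domain, so for $f \neq 0$ the localization $R_n[s, 1/f]$ is the subring
  \<open>localization f\<close> of the field of fractions of $R_n[s]$.  The variable $s$ is
  \<open>to_fract [:0, 1:]\<close>.
\<close>

type_synonym ('n, 'k) ratfun = "('n, 'k) mpol poly fract"

definition localization :: "('n::{finite,linorder}, 'k::field) mpol \<Rightarrow> ('n, 'k) ratfun set" where
  "localization f = {Fract g ([:f:] ^ k) | g k. True}"

abbreviation emb :: "('n::{finite,linorder}, 'k::field) mpol \<Rightarrow> ('n, 'k) ratfun" where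
  "emb g \<equiv> to_fract [:g:]"

abbreviation svar :: "('n::{finite,linorder}, 'k::field) ratfun" where
  "svar \<equiv> to_fract [:0, 1:]"

abbreviation pdiff_s :: "'n \<Rightarrow> ('n, 'k::field) mpol poly \<Rightarrow> ('n, 'k) mpol poly" where
  "pdiff_s i \<equiv> map_poly (pdiff i)"

lemma pdiff_s_add: "pdiff_s i (p + q) = pdiff_s i p + pdiff_s i q"
  by (rule poly_eqI) (simp add: coeff_map_poly pdiff_add)

lemma pdiff_sum: "pdiff i (sum g A) = (\<Sum>a\<in>A. pdiff i (g a))"
  by (induction A rule: infinite_finite_induct) (simp_all add: pdiff_add)

lemma pdiff_s_mult: "pdiff_s i (p * q) = pdiff_s i p * q + p * pdiff_s i q"
  by (rule poly_eqI) (simp add: coeff_map_poly coeff_mult pdiff_sum pdiff_mult sum.distrib)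

text \<open>The quotient rule; independent of the representation by \<open>fdiff_Fract\<close>.\<close>

definition fdiff :: "'n \<Rightarrow> ('n::{finite,linorder}, 'k::field) ratfun \<Rightarrow> ('n, 'k) ratfun" where
  "fdiff i u = (THE v. \<exists>a b. b \<noteq> 0 \<and> u = Fract a b \<and>
     v = Fract (pdiff_s i a * b - a * pdiff_s i b) (b * b))"

lemma quotient_rule_well_defined:
  fixes a b a' b' :: "('n::{finite,linorder}, 'k::field) mpol poly"
  assumes nz: "b \<noteq> 0" "b' \<noteq> 0" and "Fract a b = Fract a' b'"
  shows "Fract (pdiff_s i a * b - a * pdiff_s i b) (b * b) =
         Fract (pdiff_s i a' * b' - a' * pdiff_s i b') (b' * b')"
proof -
  have eq: "a * b' = a' * b" using assms by (simp add: eq_fract)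
  let ?d = "pdiff_s i"
  have "?d a * b' + a * ?d b' = ?d a' * b + a' * ?d b"
    using arg_cong[OF eq, of ?d] by (simp add: pdiff_s_mult)
  then have "(?d a * b' + a * ?d b') * (b * b') = (?d a' * b + a' * ?d b) * (b * b')"
    by simp
  with eq have "(?d a * b - a * ?d b) * (b' * b') = (?d a' * b' - a' * ?d b') * (b * b)"
    by algebra
  then show ?thesis using nz by (simp add: eq_fract)
qed

lemma fdiff_Fract:
  assumes "b \<noteq> 0"
  shows "fdiff i (Fract a b) = Fract (pdiff_s i a * b - a * pdiff_s i b) (b * b)"
  unfolding fdiff_def
proof (rule the_equality)
  show "\<exists>a' b'. b' \<noteq> 0 \<and> Fract a b = Fract a' b' \<and>
    Fract (pdiff_s i a * b - a * pdiff_s i b) (b * b) = Fract (pdiff_s i a' * b' - a' * pdiff_s i b') (b' * b')"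
    using assms by (intro exI[of _ a] exI[of _ b]) simp
next
  fix v assume "\<exists>a' b'. b' \<noteq> 0 \<and> Fract a b = Fract a' b' \<and>
    v = Fract (pdiff_s i a' * b' - a' * pdiff_s i b') (b' * b')"
  then obtain a' b' where *: "b' \<noteq> 0" "Fract a b = Fract a' b'"
    "v = Fract (pdiff_s i a' * b' - a' * pdiff_s i b') (b' * b')" by (elim exE conjE)
  show "v = Fract (pdiff_s i a * b - a * pdiff_s i b) (b * b)"
    unfolding *(3) by (rule quotient_rule_well_defined[OF assms *(1,2), symmetric])
qed

lemma pdiff_1 [simp]: "pdiff i 1 = 0"
  using pdiff_const[of i 1] by simp

lemma pdiff_s_1 [simp]: "pdiff_s i 1 = 0"
  by (simp add: map_poly_pCons one_pCons)

lemma fdiff_to_fract: "fdiff i (to_fract a) = to_fract (pdiff_s i a)"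
  by (simp add: to_fract_def fdiff_Fract)

lemma quotient_rule_add:
  fixes a b c d a' b' c' d' :: "'a::idom"
  assumes "b \<noteq> 0" "d \<noteq> 0"
  shows "Fract ((a' * d + a * d' + (c' * b + c * b')) * (b * d) - (a * d + c * b) * (b' * d + b * d')) (b * d * (b * d)) =
         Fract (a' * b - a * b') (b * b) + Fract (c' * d - c * d') (d * d)"
proof -
  have "((a' * d + a * d' + (c' * b + c * b')) * (b * d) - (a * d + c * b) * (b' * d + b * d')) * (b * b * (d * d)) =
      ((a' * b - a * b') * (d * d) + (c' * d - c * d') * (b * b)) * (b * d * (b * d))"
    by algebra
  then show ?thesis using assms by (simp only: add_fract eq_fract mult_eq_0_iff simp_thms)
qed

lemma fdiff_add: "fdiff i (u + v) = fdiff i u + fdiff i v"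
proof -
  obtain a b where u: "u = Fract a b" "b \<noteq> 0" by (cases u)
  obtain c d where v: "v = Fract c d" "d \<noteq> 0" by (cases v)
  have "b * d \<noteq> 0" using u(2) v(2) by simp
  then have "fdiff i (u + v) = Fract (pdiff_s i (a * d + c * b) * (b * d) - (a * d + c * b) * pdiff_s i (b * d)) (b * d * (b * d))"
    unfolding u(1) v(1) add_fract[OF u(2) v(2)] by (rule fdiff_Fract)
  also have "\<dots> = Fract (pdiff_s i a * b - a * pdiff_s i b) (b * b) + Fract (pdiff_s i c * d - c * pdiff_s i d) (d * d)"
    unfolding pdiff_s_mult pdiff_s_add using u(2) v(2) by (rule quotient_rule_add)
  also have "\<dots> = fdiff i u + fdiff i v"
    unfolding u(1) v(1) fdiff_Fract[OF u(2)] fdiff_Fract[OF v(2)] ..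
  finally show ?thesis .
qed

lemma quotient_rule_mult:
  fixes a b c d a' b' c' d' :: "'a::idom"
  assumes "b \<noteq> 0" "d \<noteq> 0"
  shows "Fract ((a' * c + a * c') * (b * d) - a * c * (b' * d + b * d')) (b * d * (b * d)) =
         Fract (a' * b - a * b') (b * b) * Fract c d + Fract a b * Fract (c' * d - c * d') (d * d)"
proof -
  have "((a' * c + a * c') * (b * d) - a * c * (b' * d + b * d')) * (b * b * d * (b * (d * d))) =
      ((a' * b - a * b') * c * (b * (d * d)) + a * (c' * d - c * d') * (b * b * d)) * (b * d * (b * d))"
    by algebra
  then show ?thesis using assms by (simp only: mult_fract add_fract eq_fract mult_eq_0_iff simp_thms)
qed

lemma fdiff_mult: "fdiff i (u * v) = fdiff i u * v + u * fdiff i v"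
proof -
  obtain a b where u: "u = Fract a b" "b \<noteq> 0" by (cases u)
  obtain c d where v: "v = Fract c d" "d \<noteq> 0" by (cases v)
  have "b * d \<noteq> 0" using u(2) v(2) by simp
  then have "fdiff i (u * v) = Fract (pdiff_s i (a * c) * (b * d) - a * c * pdiff_s i (b * d)) (b * d * (b * d))"
    unfolding u(1) v(1) mult_fract by (rule fdiff_Fract)
  also have "\<dots> = Fract (pdiff_s i a * b - a * pdiff_s i b) (b * b) * Fract c d + Fract a b * Fract (pdiff_s i c * d - c * pdiff_s i d) (d * d)"
    unfolding pdiff_s_mult using u(2) v(2) by (rule quotient_rule_mult)
  also have "\<dots> = fdiff i u * v + u * fdiff i v"
    unfolding u(1) v(1) fdiff_Fract[OF u(2)] fdiff_Fract[OF v(2)] ..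
  finally show ?thesis .
qed

lemma fdiff_0 [simp]: "fdiff i 0 = 0"
  using fdiff_add[of i 0 0] by (simp only: add_0 add_cancel_right_right)

lemma fdiff_uminus: "fdiff i (- u) = - fdiff i u"
  using fdiff_add[of i u "- u"] by (simp add: eq_neg_iff_add_eq_0 add.commute)

lemma fdiff_emb: "fdiff i (emb g) = emb (pdiff i g)"
  by (simp add: fdiff_to_fract map_poly_pCons)

lemma fdiff_svar: "fdiff i svar = 0"
  by (simp add: fdiff_to_fract map_poly_pCons)

lemma fdiff_commute:
  fixes u :: "('n::{finite,linorder}, 'k::field) ratfun"
  shows "fdiff i (fdiff j u) = fdiff j (fdiff i u)"
proof -
  define C where "C v = fdiff i (fdiff j v) - fdiff j (fdiff i v)" for v :: "('n, 'k) ratfun"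
  have Cmult: "C (v * w) = C v * w + v * C w" for v w
    by (simp add: C_def fdiff_mult fdiff_add algebra_simps)
  have C0: "C (to_fract a) = 0" for a
    by (simp add: C_def fdiff_to_fract map_poly_map_poly o_def pdiff_commute)
  obtain a b where u: "u = Fract a b" "b \<noteq> 0" by (cases u)
  then have "u * to_fract b = to_fract a" by (simp add: to_fract_def eq_fract)
  then have "C u * to_fract b = 0" using Cmult[of u "to_fract b"] C0 by simp
  then show ?thesis using u by (simp add: C_def)
qed


section \<open>The Weyl algebra\<close>

text \<open>Words form the free monoid; polynomial mappings on it form the free algebra.\<close>

datatype 'a fmon = Word "'a list"

instantiation fmon :: (type) monoid_add
begin
definition "0 = Word []"
fun plus_fmon where "Word u + Word v = Word (u @ v)"
instance
proof
  fix a b c :: "'a fmon"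
  show "a + b + c = a + (b + c)" by (cases a; cases b; cases c) simp
  show "0 + a = a" "a + 0 = a" by (cases a; simp add: zero_fmon_def)+
qed
end

datatype 'n weyl_gen = GX 'n | GD 'n

type_synonym ('n, 'k) free_alg = "'n weyl_gen fmon \<Rightarrow>\<^sub>0 'k"

definition free_gen :: "'n weyl_gen \<Rightarrow> ('n, 'k::field) free_alg" where
  "free_gen g = Poly_Mapping.single (Word [g]) 1"

definition weyl_relations :: "('n, 'k::field) free_alg set" where
  "weyl_relations =
     {free_gen (GD i) * free_gen (GX j) - (free_gen (GX j) * free_gen (GD i) + (if i = j then 1 else 0)) | i j. True}
   \<union> {free_gen (GX j) * free_gen (GX i) - free_gen (GX i) * free_gen (GX j) | i j. True}
   \<union> {free_gen (GD j) * free_gen (GD i) - free_gen (GD i) * free_gen (GD j) | i j. True}"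

text \<open>
  An element $g \cdot f^s$ of the free module of rank one on the symbol $f^s$ is represented
  by its coefficient $g$, so \<open>1\<close> represents $f^s$ itself.  The coefficients of
  $M = R_n[s, 1/f] \cdot f^s$ are those in \<open>localization f\<close>; the actions below are defined on
  the ambient field, and restrict to $M$ by \<open>act_localization\<close>.
\<close>

fun gen_act :: "('n::{finite,linorder}, 'k::field) mpol \<Rightarrow> 'n weyl_gen \<Rightarrow> ('n, 'k) ratfun \<Rightarrow> ('n, 'k) ratfun" where
  "gen_act f (GX i) v = emb (mvar i) * v"
| "gen_act f (GD i) v = fdiff i v + svar * v * emb (pdiff i f) * (1 / emb f)"

fun word_act :: "('n::{finite,linorder}, 'k::field) mpol \<Rightarrow> 'n weyl_gen fmon \<Rightarrow> ('n, 'k) ratfun \<Rightarrow> ('n, 'k) ratfun" where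
  "word_act f (Word w) v = foldr (gen_act f) w v"

definition free_act :: "('n::{finite,linorder}, 'k::field) mpol \<Rightarrow> ('n, 'k) free_alg \<Rightarrow> ('n, 'k) ratfun \<Rightarrow> ('n, 'k) ratfun" where
  "free_act f p v = (\<Sum>w\<in>Poly_Mapping.keys p.
     emb (Poly_Mapping.single 0 (Poly_Mapping.lookup p w)) * word_act f w v)"

lemma emb_const_add: "emb (Poly_Mapping.single 0 (a + b)) = emb (Poly_Mapping.single 0 a) + emb (Poly_Mapping.single 0 b)"
  by (simp add: single_add flip: to_fract_add)

lemma emb_const_mult: "emb (Poly_Mapping.single 0 (a * b)) = emb (Poly_Mapping.single 0 a) * emb (Poly_Mapping.single 0 b)"
  by (simp add: mult_single mult.commute flip: to_fract_mult)

lemma emb_const_0 [simp]: "emb (Poly_Mapping.single 0 0) = 0"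
  by simp

lemma emb_1 [simp]: "emb 1 = 1"
  by (simp add: one_pCons[symmetric])

lemma emb_const_1 [simp]: "emb (Poly_Mapping.single 0 1) = 1"
  by (simp add: one_pCons[symmetric])

lemma gen_act_add: "gen_act f g (u + v) = gen_act f g u + gen_act f g v"
  by (cases g) (simp_all add: fdiff_add algebra_simps)

lemma gen_act_const: "gen_act f g (emb (Poly_Mapping.single 0 c) * v) = emb (Poly_Mapping.single 0 c) * gen_act f g v"
  by (cases g) (simp_all add: fdiff_mult fdiff_emb pdiff_const algebra_simps)

lemma gen_act_svar: "gen_act f g (svar * v) = svar * gen_act f g v"
  by (cases g) (simp_all add: fdiff_mult fdiff_svar algebra_simps)

lemma word_act_add: "word_act f w (u + v) = word_act f w u + word_act f w v"
proof (cases w)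
  case (Word l)
  have "foldr (gen_act f) l (u + v) = foldr (gen_act f) l u + foldr (gen_act f) l v"
    by (induction l) (simp_all add: gen_act_add)
  then show ?thesis using Word by simp
qed

lemma word_act_const: "word_act f w (emb (Poly_Mapping.single 0 c) * v) = emb (Poly_Mapping.single 0 c) * word_act f w v"
proof (cases w)
  case (Word l)
  have "foldr (gen_act f) l (emb (Poly_Mapping.single 0 c) * v) = emb (Poly_Mapping.single 0 c) * foldr (gen_act f) l v"
    by (induction l) (simp_all add: gen_act_const)
  then show ?thesis using Word by simp
qed

lemma word_act_svar: "word_act f w (svar * v) = svar * word_act f w v"
proof (cases w)
  case (Word l)
  have "foldr (gen_act f) l (svar * v) = svar * foldr (gen_act f) l v"
    by (induction l) (simp_all add: gen_act_svar)
  then show ?thesis using Word by simp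
qed

lemma word_act_plus: "word_act f (w + w') v = word_act f w (word_act f w' v)"
  by (cases w; cases w') simp

lemma word_act_zero: "word_act f 0 v = v"
  by (simp add: zero_fmon_def)

lemma free_act_0 [simp]: "free_act f 0 v = 0"
  by (simp add: free_act_def)

lemma free_act_add: "free_act f (p + q) v = free_act f p v + free_act f q v"
  unfolding free_act_def
  by (rule keys_sum_add[where g = "\<lambda>w c. emb (Poly_Mapping.single 0 c) * word_act f w v"])
     (simp_all add: emb_const_add algebra_simps)

lemma free_act_single: "free_act f (Poly_Mapping.single w c) v = emb (Poly_Mapping.single 0 c) * word_act f w v"
  by (cases "c = 0") (simp_all add: free_act_def)

lemma word_act_0 [simp]: "word_act f w 0 = 0"
  using word_act_add[of f w 0 0] by (simp only: add_0 add_cancel_right_right)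

lemma free_act_add_right: "free_act f p (u + v) = free_act f p u + free_act f p v"
  by (simp add: free_act_def word_act_add distrib_left sum.distrib)

lemma free_act_zero_right [simp]: "free_act f p 0 = 0"
  by (simp add: free_act_def)

lemma free_act_const: "free_act f p (emb (Poly_Mapping.single 0 c) * v) = emb (Poly_Mapping.single 0 c) * free_act f p v"
  by (simp only: free_act_def word_act_const sum_distrib_left mult.left_commute)

lemma free_act_svar: "free_act f p (svar * v) = svar * free_act f p v"
  by (simp only: free_act_def word_act_svar sum_distrib_left mult.left_commute)

lemma free_act_mult: "free_act f (p * q) v = free_act f p (free_act f q v)"
proof (induction p rule: pm_induct)
  case (add_single w c p)
  have "free_act f (Poly_Mapping.single w c * q) v = free_act f (Poly_Mapping.single w c) (free_act f q v)"
  proof (induction q rule: pm_induct)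
    case (add_single w' c' q)
    then show ?case
      by (simp add: distrib_left free_act_add free_act_add_right mult_single free_act_single
          word_act_plus word_act_const emb_const_mult mult.assoc)
  qed simp
  with add_single show ?case by (simp add: distrib_right free_act_add)
qed simp

lemma free_act_uminus: "free_act f (- p) v = - free_act f p v"
  using free_act_add[of f p "- p" v] by (simp add: eq_neg_iff_add_eq_0 add.commute)

lemma free_act_diff: "free_act f (p - q) v = free_act f p v - free_act f q v"
  using free_act_add[of f p "- q" v] by (simp add: free_act_uminus)

lemma free_act_gen: "free_act f (free_gen g) v = gen_act f g v"
  by (simp add: free_gen_def free_act_single del: emb_const_0)

lemma free_act_1: "free_act f 1 v = v"
  using free_act_single[of f 0 1 v] by (simp only: single_one) (simp add: zero_fmon_def)

lemma logdiff_symmetric: "fdiff i (emb (pdiff j f) * (1 / emb f)) = fdiff j (emb (pdiff i f) * (1 / emb f))"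
proof (cases "f = 0")
  case False
  then have nz: "emb f \<noteq> 0" by simp
  have *: "fdiff k (emb g * (1 / emb f)) * (emb f * emb f) = emb (pdiff k g) * emb f - emb g * emb (pdiff k f)" for k g
  proof -
    define q where "q = emb g * (1 / emb f)"
    have q: "q * emb f = emb g" using nz by (simp add: q_def)
    then have "fdiff k q * emb f + q * emb (pdiff k f) = emb (pdiff k g)"
      by (metis fdiff_emb fdiff_mult)
    then have "(fdiff k q * emb f + q * emb (pdiff k f)) * emb f = emb (pdiff k g) * emb f"
      by simp
    then have "fdiff k q * (emb f * emb f) = emb (pdiff k g) * emb f - (q * emb f) * emb (pdiff k f)"
      by (simp only: algebra_simps eq_diff_eq)
    then have "fdiff k q * (emb f * emb f) = emb (pdiff k g) * emb f - emb g * emb (pdiff k f)"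
      by (simp only: q)
    then show ?thesis unfolding q_def .
  qed
  have "fdiff i (emb (pdiff j f) * (1 / emb f)) * (emb f * emb f) = fdiff j (emb (pdiff i f) * (1 / emb f)) * (emb f * emb f)"
    unfolding * by (simp add: pdiff_commute mult_ac)
  then show ?thesis using nz by simp
qed simp

lemma free_act_relations:
  assumes "r \<in> weyl_relations"
  shows "free_act f r v = 0"
proof -
  have 1: "gen_act f (GD i) (gen_act f (GX j) v) = gen_act f (GX j) (gen_act f (GD i) v) + free_act f (if i = j then 1 else 0) v" for i j
    by (simp add: fdiff_mult fdiff_emb pdiff_mvar free_act_1 one_pCons[symmetric] algebra_simps)
  have 2: "gen_act f (GX j) (gen_act f (GX i) v) = gen_act f (GX i) (gen_act f (GX j) v)" for i j
    by (simp add: algebra_simps)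
  have 3: "gen_act f (GD j) (gen_act f (GD i) v) = gen_act f (GD i) (gen_act f (GD j) v)" for i j
  proof -
    define l where "l k = emb (pdiff k f) * (1 / emb f)" for k
    have l: "fdiff i (l j) = fdiff j (l i)" by (simp only: l_def logdiff_symmetric)
    have g: "gen_act f (GD k) u = fdiff k u + svar * u * l k" for k u by (simp add: l_def)
    show ?thesis
      unfolding g by (simp add: fdiff_add fdiff_mult fdiff_svar l fdiff_commute[of j i] algebra_simps)
  qed
  show ?thesis
    using assms unfolding weyl_relations_def
    by (auto simp only: Un_iff mem_Collect_eq free_act_diff free_act_add free_act_mult free_act_gen 1 2 3 diff_self
        simp flip: 3)
qed

lemma free_act_ideal:
  assumes "r \<in> two_sided_ideal weyl_relations"
  shows "free_act f r v = 0"
  using assms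
  by (induction arbitrary: v rule: two_sided_ideal.induct)
     (simp_all add: free_act_relations free_act_add free_act_mult)

lemma two_sided_ideal_uminus: "x \<in> two_sided_ideal S \<Longrightarrow> - x \<in> two_sided_ideal S"
  using two_sided_ideal.lmult[of x S "- 1"] by simp

lemma ideal_eqI: "p = q \<Longrightarrow> p - q \<in> two_sided_ideal S"
  by (simp add: two_sided_ideal.zero)

quotient_type (overloaded) ('n, 'k) weyl = "('n::{finite,linorder}, 'k::field) free_alg" /
  "\<lambda>p q. p - q \<in> two_sided_ideal weyl_relations"
  morphisms rep_weyl abs_weyl
proof (intro equivpI reflpI sympI transpI)
  fix x y z :: "('n, 'k) free_alg"
  show "x - x \<in> two_sided_ideal weyl_relations" by (rule ideal_eqI) simp
  show "y - x \<in> two_sided_ideal weyl_relations" if "x - y \<in> two_sided_ideal weyl_relations"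
    using two_sided_ideal_uminus[OF that] by simp
  show "x - z \<in> two_sided_ideal weyl_relations"
    if "x - y \<in> two_sided_ideal weyl_relations" "y - z \<in> two_sided_ideal weyl_relations"
    using two_sided_ideal.add[OF that] by simp
qed

instantiation weyl :: ("{finite,linorder}", field) ring_1
begin

lift_definition zero_weyl :: "('a, 'b) weyl" is 0 .
lift_definition one_weyl :: "('a, 'b) weyl" is 1 .
lift_definition plus_weyl :: "('a, 'b) weyl \<Rightarrow> ('a, 'b) weyl \<Rightarrow> ('a, 'b) weyl" is "(+)"
  by (simp only: add_diff_add two_sided_ideal.add)
lift_definition uminus_weyl :: "('a, 'b) weyl \<Rightarrow> ('a, 'b) weyl" is uminus
  by (simp only: minus_diff_minus two_sided_ideal_uminus)
lift_definition minus_weyl :: "('a, 'b) weyl \<Rightarrow> ('a, 'b) weyl \<Rightarrow> ('a, 'b) weyl" is "(-)"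
proof -
  fix a b c d :: "('a, 'b) free_alg"
  assume *: "a - b \<in> two_sided_ideal weyl_relations" "c - d \<in> two_sided_ideal weyl_relations"
  have eq: "a - c - (b - d) = (a - b) + - (c - d)" by simp
  show "a - c - (b - d) \<in> two_sided_ideal weyl_relations"
    unfolding eq by (intro two_sided_ideal.add two_sided_ideal_uminus *)
qed
lift_definition times_weyl :: "('a, 'b) weyl \<Rightarrow> ('a, 'b) weyl \<Rightarrow> ('a, 'b) weyl" is "(*)"
proof -
  fix a b c d :: "('a, 'b) free_alg"
  assume *: "a - b \<in> two_sided_ideal weyl_relations" "c - d \<in> two_sided_ideal weyl_relations"
  have eq: "a * c - b * d = (a - b) * c + b * (c - d)" by (simp add: algebra_simps)
  show "a * c - b * d \<in> two_sided_ideal weyl_relations"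
    unfolding eq by (rule two_sided_ideal.add[OF two_sided_ideal.rmult[OF *(1)] two_sided_ideal.lmult[OF *(2)]])
qed

instance
proof
  show "(0::('a, 'b) weyl) \<noteq> 1"
  proof (transfer, rule notI)
    assume "0 - (1::('a, 'b) free_alg) \<in> two_sided_ideal weyl_relations"
    from free_act_ideal[OF this, of 1 1] show False
      by (simp add: free_act_uminus free_act_1)
  qed
qed (transfer, rule ideal_eqI, simp add: algebra_simps)+

end

definition weyl_const :: "'k::field \<Rightarrow> ('n::{finite,linorder}, 'k) weyl" where
  "weyl_const c = abs_weyl (Poly_Mapping.single 0 c)"

definition weyl_x :: "'n::{finite,linorder} \<Rightarrow> ('n, 'k::field) weyl" where
  "weyl_x i = abs_weyl (free_gen (GX i))"

definition weyl_d :: "'n::{finite,linorder} \<Rightarrow> ('n, 'k::field) weyl" where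
  "weyl_d i = abs_weyl (free_gen (GD i))"

lift_definition weyl_act :: "('n::{finite,linorder}, 'k::field) mpol \<Rightarrow> ('n, 'k) weyl \<Rightarrow> ('n, 'k) ratfun \<Rightarrow> ('n, 'k) ratfun"
  is free_act
proof (rule ext)
  fix f :: "('n, 'k) mpol" and p q :: "('n, 'k) free_alg" and v
  assume "p - q \<in> two_sided_ideal weyl_relations"
  from free_act_ideal[OF this, of f v] show "free_act f p v = free_act f q v"
    by (simp add: free_act_diff)
qed

lemma weyl_relation_d_x: "weyl_d i * weyl_x j = weyl_x j * weyl_d i + (if i = j then 1 else 0)"
proof -
  have "free_gen (GD i) * free_gen (GX j) - (free_gen (GX j) * free_gen (GD i) + (if i = j then 1 else 0))
     \<in> two_sided_ideal (weyl_relations :: ('a, 'b) free_alg set)"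
    by (rule two_sided_ideal.gen) (auto simp only: weyl_relations_def)
  then show ?thesis
    unfolding weyl_d_def weyl_x_def
    by (simp add: times_weyl.abs_eq plus_weyl.abs_eq one_weyl_def weyl.abs_eq_iff split: if_splits)
qed

lemma weyl_act_0 [simp]: "weyl_act f 0 v = 0"
  by transfer simp

lemma weyl_act_add: "weyl_act f (p + q) v = weyl_act f p v + weyl_act f q v"
  by transfer (rule free_act_add)

lemma weyl_act_add_right: "weyl_act f p (u + v) = weyl_act f p u + weyl_act f p v"
  by transfer (rule free_act_add_right)

lemma weyl_act_0_right [simp]: "weyl_act f p 0 = 0"
  by transfer simp

lemma weyl_act_mult: "weyl_act f (p * q) v = weyl_act f p (weyl_act f q v)"
  by transfer (rule free_act_mult)

lemma weyl_act_1 [simp]: "weyl_act f 1 v = v"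
  by transfer (rule free_act_1)

lemma weyl_act_x: "weyl_act f (weyl_x i) v = emb (mvar i) * v"
  by (simp only: weyl_x_def weyl_act.abs_eq free_act_gen gen_act.simps)

lemma weyl_act_d: "weyl_act f (weyl_d i) v = fdiff i v + svar * v * emb (pdiff i f) * (1 / emb f)"
  by (simp only: weyl_d_def weyl_act.abs_eq free_act_gen gen_act.simps)

lemma weyl_act_const: "weyl_act f (weyl_const c) v = emb (Poly_Mapping.single 0 c) * v"
  by (simp only: weyl_const_def weyl_act.abs_eq free_act_single word_act_zero)

lemma weyl_act_svar: "weyl_act f p (svar ^ k * v) = svar ^ k * weyl_act f p v"
proof (induction k)
  case (Suc k)
  have "weyl_act f p (svar * u) = svar * weyl_act f p u" for u
    by (induction p rule: weyl.abs_induct) (simp only: weyl_act.abs_eq free_act_svar)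
  with Suc show ?case by (simp only: power_Suc mult.assoc)
qed simp

definition weyl_poly :: "('n::{finite,linorder}, 'k::field) mpol \<Rightarrow> ('n, 'k) weyl" where
  "weyl_poly p = (\<Sum>m\<in>Poly_Mapping.keys p. weyl_const (Poly_Mapping.lookup p m) *
     (\<Prod>i\<leftarrow>sorted_list_of_set UNIV. weyl_x i ^ Poly_Mapping.lookup m i))"


section \<open>$D_n[s]$ and its action on $R_n[s, 1/f] \cdot f^s$\<close>

text \<open>
  The convolution product on \<open>nat \<Rightarrow>\<^sub>0 A\<close> is the polynomial ring \<open>A[s]\<close> with a central
  variable also for noncommutative \<open>A\<close> (the library type \<open>poly\<close> requires commutativity).
\<close>

type_synonym ('n, 'k) weyl_s = "nat \<Rightarrow>\<^sub>0 ('n, 'k) weyl"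

definition weyl_s_of_mpol :: "('n::{finite,linorder}, 'k::field) mpol \<Rightarrow> ('n, 'k) weyl_s" where
  "weyl_s_of_mpol p = Poly_Mapping.single 0 (weyl_poly p)"

definition weyl_s_of_poly :: "'k poly \<Rightarrow> ('n::{finite,linorder}, 'k::field) weyl_s" where
  "weyl_s_of_poly q = (\<Sum>k\<le>degree q. Poly_Mapping.single k (weyl_const (coeff q k)))"

definition subst_s :: "'k \<Rightarrow> ('n::{finite,linorder}, 'k::field) weyl_s \<Rightarrow> ('n, 'k) weyl" where
  "subst_s c P = (\<Sum>k\<in>Poly_Mapping.keys P. Poly_Mapping.lookup P k * weyl_const (c ^ k))"

definition act :: "('n::{finite,linorder}, 'k::field) mpol \<Rightarrow> ('n, 'k) weyl_s \<Rightarrow> ('n, 'k) ratfun \<Rightarrow> ('n, 'k) ratfun" where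
  "act f P v = (\<Sum>k\<in>Poly_Mapping.keys P. svar ^ k * weyl_act f (Poly_Mapping.lookup P k) v)"

lemma act_0 [simp]: "act f 0 v = 0"
  by (simp add: act_def)

lemma act_add: "act f (P + Q) v = act f P v + act f Q v"
  unfolding act_def
  by (rule keys_sum_add[where g = "\<lambda>k a. svar ^ k * weyl_act f a v"])
     (simp_all add: weyl_act_add distrib_left)

lemma act_single: "act f (Poly_Mapping.single k a) v = svar ^ k * weyl_act f a v"
  by (cases "a = 0") (simp_all add: act_def)

lemma act_add_right: "act f P (u + v) = act f P u + act f P v"
  by (simp add: act_def weyl_act_add_right distrib_left sum.distrib)

lemma act_0_right [simp]: "act f P 0 = 0"
  by (simp add: act_def)

lemma act_mult: "act f (P * Q) v = act f P (act f Q v)"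
proof (induction P rule: pm_induct)
  case (add_single k a P)
  have "act f (Poly_Mapping.single k a * Q) v = act f (Poly_Mapping.single k a) (act f Q v)"
  proof (induction Q rule: pm_induct)
    case (add_single l b Q)
    have "act f (Poly_Mapping.single k a * Poly_Mapping.single l b) v =
        act f (Poly_Mapping.single k a) (act f (Poly_Mapping.single l b) v)"
      by (simp only: mult_single act_single weyl_act_svar weyl_act_mult power_add mult.assoc)
    with add_single show ?case
      by (simp only: distrib_left act_add act_add_right)
  qed simp
  with add_single show ?case by (simp only: distrib_right act_add)
qed simp

lemma act_1: "act f 1 v = v"
  using act_single[of f 0 1 v] by simp

lemma act_uminus: "act f (- P) v = - act f P v"
  using act_add[of f P "- P" v] by (simp add: eq_neg_iff_add_eq_0 add.commute)

lemma pm_exponent_prod: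
  fixes m :: "'n::{finite,linorder} \<Rightarrow>\<^sub>0 nat"
  shows "(\<Prod>i\<in>UNIV. mvar i ^ Poly_Mapping.lookup m i) = (Poly_Mapping.single m 1 :: ('n, 'k::field) mpol)"
proof -
  have pow: "mvar i ^ k = (Poly_Mapping.single (Poly_Mapping.single i k) 1 :: ('n, 'k) mpol)" for i k
    by (induction k) (simp_all add: mvar_def mult_single single_add[symmetric])
  have "(\<Prod>i\<in>A. Poly_Mapping.single (e i) 1) = (Poly_Mapping.single (\<Sum>i\<in>A. e i) 1 :: ('n, 'k) mpol)"
    if "finite A" for A :: "'n set" and e
    using that by (induction A rule: finite_induct) (simp_all add: mult_single)
  then have "(\<Prod>i\<in>UNIV. mvar i ^ Poly_Mapping.lookup m i) =
      (Poly_Mapping.single (\<Sum>i\<in>UNIV. Poly_Mapping.single i (Poly_Mapping.lookup m i)) 1 :: ('n, 'k) mpol)"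
    by (simp add: pow)
  also have "(\<Sum>i\<in>UNIV. Poly_Mapping.single i (Poly_Mapping.lookup m i)) = m"
    by (rule poly_mapping_eqI) (simp add: lookup_sum lookup_single when_def)
  finally show ?thesis .
qed

lemma emb_mult: "emb (a * b) = emb a * emb b"
  by (simp add: mult.commute flip: to_fract_mult)

lemma emb_add: "emb (a + b) = emb a + emb b"
  by (simp flip: to_fract_add)

lemma weyl_act_poly: "weyl_act f (weyl_poly p) v = emb p * v"
proof -
  have sum: "weyl_act f (\<Sum>m\<in>A. g m) v = (\<Sum>m\<in>A. weyl_act f (g m) v)" for g :: "('a \<Rightarrow>\<^sub>0 nat) \<Rightarrow> _" and A
    by (induction A rule: infinite_finite_induct) (simp_all add: weyl_act_add)
  have embsum: "emb (\<Sum>m\<in>A. g m) = (\<Sum>m\<in>A. emb (g m))" for g :: "('a \<Rightarrow>\<^sub>0 nat) \<Rightarrow> ('a, 'b) mpol" and A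
    by (induction A rule: infinite_finite_induct) (simp_all add: emb_add del: to_fract_add)
  have pow: "weyl_act f (weyl_x i ^ k) u = emb (mvar i ^ k) * u" for i k u
    by (induction k arbitrary: u) (simp_all add: weyl_act_mult weyl_act_x emb_mult mult.assoc)
  have "weyl_act f (\<Prod>i\<leftarrow>l. weyl_x i ^ e i) u = emb (\<Prod>i\<leftarrow>l. mvar i ^ e i) * u" for l e u
    by (induction l arbitrary: u) (simp_all add: weyl_act_mult pow emb_mult mult.assoc)
  moreover have "(\<Prod>i\<leftarrow>sorted_list_of_set UNIV. mvar i ^ Poly_Mapping.lookup m i) = (Poly_Mapping.single m 1 :: ('a, 'b) mpol)" for m
    by (subst prod.distinct_set_conv_list[symmetric]) (simp_all add: pm_exponent_prod)
  ultimately have mon: "weyl_act f (\<Prod>i\<leftarrow>sorted_list_of_set UNIV. weyl_x i ^ Poly_Mapping.lookup m i) u = emb (Poly_Mapping.single m 1) * u" for m u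
    by simp
  have "weyl_act f (weyl_poly p) v = (\<Sum>m\<in>Poly_Mapping.keys p. emb (Poly_Mapping.single 0 (Poly_Mapping.lookup p m) * Poly_Mapping.single m 1) * v)"
    by (simp only: weyl_poly_def sum weyl_act_mult weyl_act_const mon emb_mult mult.assoc)
  also have "\<dots> = emb p * v"
    by (subst (3) pm_sum_single[of p]) (simp only: mult_single add_0 mult_1_right embsum sum_distrib_right)
  finally show ?thesis .
qed

lemma act_mpol: "act f (weyl_s_of_mpol p) v = emb p * v"
  by (simp add: weyl_s_of_mpol_def act_single weyl_act_poly)

lemma act_poly: "act f (weyl_s_of_poly q) v = to_fract (map_poly (Poly_Mapping.single 0) q) * v"
proof -
  have sum: "act f (\<Sum>k\<in>A. g k) v = (\<Sum>k\<in>A. act f (g k) v)" for g :: "nat \<Rightarrow> _" and A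
    by (induction A rule: infinite_finite_induct) (simp_all add: act_add)
  have fsum: "to_fract (\<Sum>k\<in>A. g k) = (\<Sum>k\<in>A. to_fract (g k))" for g :: "nat \<Rightarrow> ('a, 'b) mpol poly" and A
    by (induction A rule: infinite_finite_induct) simp_all
  have fpow: "to_fract (p ^ k) = to_fract p ^ k" for p :: "('a, 'b) mpol poly" and k
    by (induction k) simp_all
  have "map_poly (Poly_Mapping.single 0) q = (\<Sum>k\<le>degree q. [:0, 1:] ^ k * [:Poly_Mapping.single 0 (coeff q k) :: ('a, 'b) mpol:])"
    by (rule poly_eqI)
       (auto simp: coeff_map_poly coeff_sum coeff_eq_0 simp flip: monom_altdef)
  then show ?thesis
    by (simp only: weyl_s_of_poly_def sum act_single weyl_act_const fsum fpow to_fract_mult sum_distrib_right mult.assoc)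
qed

lemma localization_iff:
  assumes "f \<noteq> 0"
  shows "v \<in> localization f \<longleftrightarrow> (\<exists>g k. v * emb f ^ k = to_fract g)"
proof -
  have fpow: "to_fract (p ^ k) = to_fract p ^ k" for p :: "('a, 'b) mpol poly" and k
    by (induction k) simp_all
  have "v = Fract g ([:f:] ^ k) \<longleftrightarrow> v * emb f ^ k = to_fract g" for g k
  proof -
    have "Fract g ([:f:] ^ k) * emb f ^ k = to_fract g"
      using assms by (simp add: fpow[symmetric]) (simp add: to_fract_def eq_fract)
    moreover have "emb f ^ k \<noteq> 0" using assms by simp
    ultimately show ?thesis by (metis mult_right_cancel)
  qed
  then show ?thesis by (auto simp: localization_def)
qed

lemma sum_closed:
  assumes "0 \<in> L" "\<And>u w. u \<in> L \<Longrightarrow> w \<in> L \<Longrightarrow> u + w \<in> L" "\<And>a. a \<in> A \<Longrightarrow> g a \<in> L"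
  shows "sum g A \<in> L"
  using assms(3) by (induction A rule: infinite_finite_induct) (simp_all add: assms(1,2))

lemma act_localization:
  assumes "f \<noteq> 0" "v \<in> localization f"
  shows "act f P v \<in> localization f"
proof -
  note iff = localization_iff[OF assms(1)]
  have fpow: "to_fract (p ^ k) = to_fract p ^ k" for p :: "('a, 'b) mpol poly" and k
    by (induction k) simp_all
  have addc: "u + w \<in> localization f" if uw: "u \<in> localization f" "w \<in> localization f" for u w
  proof -
    obtain g k h l where *: "u * emb f ^ k = to_fract g" "w * emb f ^ l = to_fract h"
      using uw unfolding iff by blast
    have "(u + w) * emb f ^ (k + l) = (u * emb f ^ k) * emb f ^ l + (w * emb f ^ l) * emb f ^ k"
      by (simp only: power_add algebra_simps)
    also have "\<dots> = to_fract (g * [:f:] ^ l + h * [:f:] ^ k)"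
      unfolding * by (simp only: to_fract_add to_fract_mult fpow)
    finally show ?thesis unfolding iff by blast
  qed
  have multc: "u * w \<in> localization f" if uw: "u \<in> localization f" "w \<in> localization f" for u w
  proof -
    obtain g k h l where *: "u * emb f ^ k = to_fract g" "w * emb f ^ l = to_fract h"
      using uw unfolding iff by blast
    have "(u * w) * emb f ^ (k + l) = (u * emb f ^ k) * (w * emb f ^ l)"
      by (simp only: power_add algebra_simps)
    also have "\<dots> = to_fract (g * h)"
      unfolding * by (simp only: to_fract_mult)
    finally show ?thesis unfolding iff by blast
  qed
  have poly: "to_fract g \<in> localization f" for g
    unfolding iff by (intro exI[of _ g] exI[of _ 0]) simp
  have inv: "1 / emb f \<in> localization f"
    unfolding iff using assms(1) by (intro exI[of _ 1] exI[of _ 1]) simp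
  have diffc: "fdiff i u \<in> localization f" if u: "u \<in> localization f" for i u
  proof -
    obtain g k where *: "u * to_fract ([:f:] ^ k) = to_fract g"
      using u unfolding iff fpow by blast
    let ?F = "[:f:] ^ k"
    have "fdiff i u * to_fract ?F + u * to_fract (pdiff_s i ?F) = to_fract (pdiff_s i g)"
      using arg_cong[OF *, of "fdiff i"] by (simp only: fdiff_mult fdiff_to_fract)
    then have "(fdiff i u * to_fract ?F + u * to_fract (pdiff_s i ?F)) * to_fract ?F = to_fract (pdiff_s i g) * to_fract ?F"
      by simp
    then have "fdiff i u * (to_fract ?F * to_fract ?F) = to_fract (pdiff_s i g) * to_fract ?F - (u * to_fract ?F) * to_fract (pdiff_s i ?F)"
      by (simp only: algebra_simps eq_diff_eq)
    also have "\<dots> = to_fract (pdiff_s i g * ?F - g * pdiff_s i ?F)"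
      unfolding * by (simp only: to_fract_mult to_fract_diff)
    also have "to_fract ?F * to_fract ?F = emb f ^ (k + k)"
      by (simp only: fpow power_add)
    finally show ?thesis unfolding iff by blast
  qed
  have gen: "gen_act f g u \<in> localization f" if "u \<in> localization f" for g u
    using that by (cases g) (auto simp only: gen_act.simps intro!: addc multc poly inv diffc)
  have word: "word_act f w u \<in> localization f" if "u \<in> localization f" for w u
  proof (cases w)
    case (Word l)
    have "foldr (gen_act f) l u \<in> localization f"
      using that by (induction l) (simp_all add: gen)
    then show ?thesis using Word by simp
  qed
  have zero: "0 \<in> localization f" using poly[of 0] by simp
  have free: "free_act f p u \<in> localization f" if "u \<in> localization f" for p u
    unfolding free_act_def by (intro sum_closed[OF zero addc] multc poly word that)
  have weyl: "weyl_act f a u \<in> localization f" if "u \<in> localization f" for a u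
    by (induction a rule: weyl.abs_induct) (simp only: weyl_act.abs_eq free that)
  have fold: "svar ^ k \<in> localization f" for k
    using poly[of "[:0, 1:] ^ k"] unfolding fpow .
  have "(\<Sum>k\<in>A. svar ^ k * weyl_act f (Poly_Mapping.lookup P k) v) \<in> localization f" for A
    by (intro sum_closed[OF zero addc] multc weyl fold assms)
  then show ?thesis unfolding act_def .
qed


section \<open>The annihilator of $f^s$ and the Bernstein-Sato polynomial\<close>

definition ann_fs :: "('n::{finite,linorder}, 'k::field) mpol \<Rightarrow> ('n, 'k) weyl_s set" where
  "ann_fs f = {P. act f P 1 = 0}"

text \<open>The sum of ideals is the elementwise sum of sets, from \<open>Set_Algebras\<close>.\<close>

definition bs_ideal :: "('n::{finite,linorder}, 'k::field) mpol \<Rightarrow> ('n, 'k) weyl_s set" where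
  "bs_ideal f = ann_fs f + left_ideal {weyl_s_of_mpol f}"

definition has_bernstein_equation :: "('n::{finite,linorder}, 'k::field) mpol \<Rightarrow> 'k poly \<Rightarrow> bool" where
  "has_bernstein_equation f b \<longleftrightarrow>
     (\<exists>P. act f (P * weyl_s_of_mpol f) 1 = act f (weyl_s_of_poly b) 1)"

text \<open>
  A predicate rather than a definite description, since existence is Bernstein's theorem;
  the polynomial is unique by \<open>bernstein_sato_poly_unique\<close>.
\<close>

definition bernstein_sato_poly :: "('n::{finite,linorder}, 'k::field) mpol \<Rightarrow> 'k poly \<Rightarrow> bool" where
  "bernstein_sato_poly f b \<longleftrightarrow> lead_coeff b = 1 \<and> has_bernstein_equation f b \<and>
     (\<forall>c. lead_coeff c = 1 \<and> has_bernstein_equation f c \<longrightarrow> degree b \<le> degree c)"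

lemma has_bernstein_equation_iff:
  "has_bernstein_equation f b \<longleftrightarrow> (\<exists>P. act f P (emb f) = to_fract (map_poly (Poly_Mapping.single 0) b))"
  unfolding has_bernstein_equation_def by (simp only: act_mult act_mpol act_poly mult_1_right)

lemma bernstein_sato_poly_unique:
  fixes f :: "('n::{finite,linorder}, 'k::field) mpol"
  assumes "bernstein_sato_poly f b" "bernstein_sato_poly f c"
  shows "b = c"
proof (rule ccontr)
  assume "b \<noteq> c"
  define d where "d = b - c"
  define l where "l = 1 / lead_coeff d"
  have deg: "degree b = degree c" and lc: "lead_coeff b = 1" "lead_coeff c = 1"
    and eqs: "has_bernstein_equation f b" "has_bernstein_equation f c"
    and min: "\<And>e. lead_coeff e = 1 \<Longrightarrow> has_bernstein_equation f e \<Longrightarrow> degree b \<le> degree e"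
    using assms by (auto simp: bernstein_sato_poly_def intro: antisym)
  have d0: "d \<noteq> 0" using \<open>b \<noteq> c\<close> by (simp add: d_def)
  have "degree d \<le> degree b" unfolding d_def using deg by (intro degree_diff_le) auto
  moreover have "coeff d (degree b) = 0" using lc deg by (simp add: d_def)
  ultimately have less: "degree d < degree b"
    using d0 by (metis le_neq_implies_less leading_coeff_0_iff)
  obtain P Q where PQ: "act f P (emb f) = to_fract (map_poly (Poly_Mapping.single 0) b)"
    "act f Q (emb f) = to_fract (map_poly (Poly_Mapping.single 0) c)"
    using eqs unfolding has_bernstein_equation_iff by blast
  have map: "map_poly (Poly_Mapping.single 0) (smult l d) = ([:Poly_Mapping.single 0 l:] *
      (map_poly (Poly_Mapping.single 0) b - map_poly (Poly_Mapping.single 0) c) :: ('n, 'k) mpol poly)"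
    by (rule poly_eqI) (simp add: coeff_map_poly d_def mult_single flip: single_diff)
  have "act f (Poly_Mapping.single 0 (weyl_const l) * (P + (- Q))) (emb f) =
      to_fract (map_poly (Poly_Mapping.single 0) (smult l d))"
    unfolding act_mult act_add act_uminus PQ act_single weyl_act_const map to_fract_mult to_fract_diff
    by (simp only: power_0 mult_1_left add_uminus_conv_diff)
  then have "has_bernstein_equation f (smult l d)" unfolding has_bernstein_equation_iff by blast
  moreover have "lead_coeff (smult l d) = 1" using d0 by (simp add: l_def)
  ultimately have "degree b \<le> degree (smult l d)" by (rule min[rotated])
  then show False using less degree_smult_le[of l d] by linarith
qed

end

theory Submission
  imports Defs
begin

text \<open>
  Write $c = -\alpha$ and $u = s - c$, an element of the centre of $D_n[s]$, and let $m$ be the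
  multiplicity of $c$ as a root of $b$; then $b = u^m q$ with $q(c) \neq 0$.  Only two properties
  of $I$ enter the proof: it is a left ideal, and $I \cap \mathbb{K}[s]$ is
  generated by $b$, in the form that $b \in I$ while no nonzero polynomial of smaller degree lies
  in $I$ (\<open>weyl_s_of_poly_in_bs_ideal_iff\<close>, \<open>bernstein_sato_poly_degree_le\<close>).

  If $m \le i$, then $u^i q = u^{i-m} b \in I$, so $q \in I : u^i$.  Since $q(c) \neq 0$, the
  polynomials $q$ and $u$ generate the unit ideal of $\mathbb{K}[s]$, hence
  $(I : u^i) + D_n[s]\langle u\rangle = D_n[s]$.  Conversely, let $1 = j + Q u$ with $u^i j \in I$.
  If $m > i$, multiplying by the central element $u^{m-1} q$ gives
  \[ u^{m-1} q = u^{m-1-i} q \cdot u^i j + Q \cdot b \in I, \]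
  which contradicts the minimality of $\deg b$.  This argument is
  \<open>quotient_sum_eq_UNIV_iff_order_le\<close>.

  The second equivalence holds for any subset in place of $I : u^i$, because the substitution
  $s = c$ is surjective onto $D_n$ with kernel $D_n[s]\langle u\rangle$
  (\<open>weyl_s_division\<close>, \<open>subst_s_mult_linear\<close>).
\<close>

section \<open>Left ideals and their quotients\<close>

lemma left_ideal_singleton: "left_ideal {a} = range (\<lambda>r. r * a)"
proof (intro equalityI subsetI)
  fix x assume "x \<in> left_ideal {a}"
  then show "x \<in> range (\<lambda>r. r * a)"
  proof induction
    case (gen x)
    then show ?case using rangeI[of "\<lambda>r. r * a" 1] by simp
  next
    case zero
    then show ?case using rangeI[of "\<lambda>r. r * a" 0] by simp
  next
    case (add x y)
    then obtain p q where "x = p * a" "y = q * a" by blast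
    then show ?case using rangeI[of "\<lambda>r. r * a" "p + q"] by (simp add: distrib_right)
  next
    case (lmult x r)
    then obtain p where "x = p * a" by blast
    then show ?case using rangeI[of "\<lambda>r. r * a" "r * p"] by (simp add: mult.assoc)
  qed
qed (auto intro: left_ideal.intros)

lemma bs_ideal_memI:
  assumes "act f (P - Q * weyl_s_of_mpol f) 1 = 0"
  shows "P \<in> bs_ideal f"
proof -
  have "(P - Q * weyl_s_of_mpol f) + Q * weyl_s_of_mpol f \<in> bs_ideal f"
    unfolding bs_ideal_def left_ideal_singleton
    using assms by (intro set_plus_intro) (simp_all add: ann_fs_def)
  then show ?thesis by simp
qed

lemma bs_ideal_memE:
  assumes "P \<in> bs_ideal f"
  obtains A Q where "P = A + Q * weyl_s_of_mpol f" "act f A 1 = 0"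
  using assms unfolding bs_ideal_def left_ideal_singleton ann_fs_def
  by (elim set_plus_elim) blast

lemma bs_ideal_add:
  assumes "P \<in> bs_ideal f" "P' \<in> bs_ideal f"
  shows "P + P' \<in> bs_ideal f"
proof -
  obtain A Q where P: "P = A + Q * weyl_s_of_mpol f" "act f A 1 = 0"
    using assms(1) by (rule bs_ideal_memE)
  obtain A' Q' where P': "P' = A' + Q' * weyl_s_of_mpol f" "act f A' 1 = 0"
    using assms(2) by (rule bs_ideal_memE)
  have "P + P' - (Q + Q') * weyl_s_of_mpol f = A + A'"
    unfolding P(1) P'(1) by (simp add: algebra_simps)
  then show ?thesis using P(2) P'(2) by (intro bs_ideal_memI[of f _ "Q + Q'"]) (simp add: act_add)
qed

lemma bs_ideal_lmult:
  assumes "P \<in> bs_ideal f"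
  shows "R * P \<in> bs_ideal f"
proof -
  obtain A Q where P: "P = A + Q * weyl_s_of_mpol f" "act f A 1 = 0"
    using assms by (rule bs_ideal_memE)
  have "R * P - (R * Q) * weyl_s_of_mpol f = R * A"
    unfolding P(1) by (simp add: algebra_simps)
  then show ?thesis using P(2) by (intro bs_ideal_memI[of f _ "R * Q"]) (simp add: act_mult)
qed


section \<open>The central subring $\mathbb{K}[s]$ of $D_n[s]$\<close>

lemma weyl_const_0 [simp]: "weyl_const 0 = 0"
  by (simp add: weyl_const_def zero_weyl_def)

lemma weyl_const_1 [simp]: "weyl_const 1 = 1"
  by (simp add: weyl_const_def one_weyl_def)

lemma weyl_const_add: "weyl_const (a + b) = weyl_const a + weyl_const b"
  by (simp add: weyl_const_def plus_weyl.abs_eq single_add)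

lemma weyl_const_mult: "weyl_const (a * b) = weyl_const a * weyl_const b"
  by (simp add: weyl_const_def times_weyl.abs_eq mult_single)

lemma free_const_commute:
  "Poly_Mapping.single 0 a * p = p * (Poly_Mapping.single 0 a :: ('n, 'k::field) free_alg)"
  by (induction p rule: pm_induct) (simp_all add: algebra_simps mult_single)

lemma weyl_const_commute: "weyl_const a * x = x * weyl_const a"
  by (induction x rule: weyl.abs_induct)
     (simp add: weyl_const_def times_weyl.abs_eq free_const_commute)

lemma weyl_s_of_poly_0 [simp]: "weyl_s_of_poly 0 = 0"
  by (simp add: weyl_s_of_poly_def)

lemma weyl_s_of_poly_pCons:
  "weyl_s_of_poly (pCons a p) =
     Poly_Mapping.single 0 (weyl_const a) + Poly_Mapping.single 1 1 * weyl_s_of_poly p"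
proof (cases "p = 0")
  case False
  then show ?thesis
    by (simp add: weyl_s_of_poly_def sum.atMost_Suc_shift sum_distrib_left mult_single
        del: sum.atMost_Suc)
qed (simp add: weyl_s_of_poly_def)

lemma weyl_s_of_poly_1 [simp]: "weyl_s_of_poly 1 = 1"
  by (simp add: one_pCons weyl_s_of_poly_pCons)

lemma weyl_s_of_poly_add: "weyl_s_of_poly (p + q) = weyl_s_of_poly p + weyl_s_of_poly q"
  by (induction p q rule: poly_induct2)
     (simp_all add: weyl_s_of_poly_pCons weyl_const_add single_add distrib_left add_ac)

lemma single_const_commute:
  "Poly_Mapping.single k (weyl_const a) * P = P * Poly_Mapping.single k (weyl_const a)"
  for P :: "('n::{finite,linorder}, 'k::field) weyl_s"
  by (induction P rule: pm_induct)
     (simp_all add: distrib_left distrib_right mult_single weyl_const_commute add.commute)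

lemma weyl_s_of_poly_commute: "weyl_s_of_poly p * P = P * weyl_s_of_poly p"
  unfolding weyl_s_of_poly_def
  by (simp add: sum_distrib_left sum_distrib_right single_const_commute)

lemma weyl_s_of_poly_smult:
  "weyl_s_of_poly (smult a p) = Poly_Mapping.single 0 (weyl_const a) * weyl_s_of_poly p"
  for p :: "'k::field poly"
proof (induction p)
  case (pCons c p)
  have "Poly_Mapping.single 0 (weyl_const a) * (Poly_Mapping.single 1 1 * weyl_s_of_poly p) =
      Poly_Mapping.single 1 1 * (Poly_Mapping.single 0 (weyl_const a) * weyl_s_of_poly p)"
    by (simp add: mult_single flip: mult.assoc)
  from this[symmetric] show ?case
    by (simp add: weyl_s_of_poly_pCons pCons.IH weyl_const_mult mult_single distrib_left)
qed simp

lemma weyl_s_of_poly_mult: "weyl_s_of_poly (p * q) = weyl_s_of_poly p * weyl_s_of_poly q"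
proof (induction p)
  case (pCons a p)
  then show ?case
    by (simp add: weyl_s_of_poly_add weyl_s_of_poly_pCons weyl_s_of_poly_smult distrib_right
        mult.assoc)
qed simp

lemma weyl_s_of_poly_power: "weyl_s_of_poly (p ^ k) = weyl_s_of_poly p ^ k"
  by (induction k) (simp_all add: weyl_s_of_poly_mult)

text \<open>
  A Bernstein equation $P f \cdot f^s = q \cdot f^s$ says that $q - P f$ annihilates $f^s$.
\<close>

lemma weyl_s_of_poly_in_bs_ideal_iff:
  "weyl_s_of_poly q \<in> bs_ideal f \<longleftrightarrow> has_bernstein_equation f q"
proof
  assume "weyl_s_of_poly q \<in> bs_ideal f"
  then obtain A P where "weyl_s_of_poly q = A + P * weyl_s_of_mpol f" "act f A 1 = 0"
    by (rule bs_ideal_memE)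
  then show "has_bernstein_equation f q"
    unfolding has_bernstein_equation_def by (metis act_add add_0)
next
  assume "has_bernstein_equation f q"
  then obtain P where P: "act f (P * weyl_s_of_mpol f) 1 = act f (weyl_s_of_poly q) 1"
    unfolding has_bernstein_equation_def by blast
  have "act f (weyl_s_of_poly q - P * weyl_s_of_mpol f) 1 =
      act f (weyl_s_of_poly q) 1 - act f (P * weyl_s_of_mpol f) 1"
    using act_add[of f "weyl_s_of_poly q" "- (P * weyl_s_of_mpol f)" 1]
    by (simp add: act_uminus)
  then show "weyl_s_of_poly q \<in> bs_ideal f"
    using P by (intro bs_ideal_memI[of f _ P]) simp
qed

text \<open>
  Minimality is stated for monic polynomials; dividing by the leading coefficient extends it to
  all nonzero elements of $I \cap \mathbb{K}[s]$.
\<close>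

lemma bernstein_sato_poly_degree_le:
  assumes b: "bernstein_sato_poly f b" and q: "weyl_s_of_poly q \<in> bs_ideal f" "q \<noteq> 0"
  shows "degree b \<le> degree q"
proof -
  let ?q = "smult (1 / lead_coeff q) q"
  have "weyl_s_of_poly ?q \<in> bs_ideal f"
    unfolding weyl_s_of_poly_smult by (rule bs_ideal_lmult[OF q(1)])
  then have "has_bernstein_equation f ?q" by (simp only: weyl_s_of_poly_in_bs_ideal_iff)
  moreover have "lead_coeff ?q = 1" using q(2) by simp
  ultimately have "degree b \<le> degree ?q" using b unfolding bernstein_sato_poly_def by blast
  then show ?thesis using q(2) by simp
qed


section \<open>Substituting a constant for $s$\<close>

lemma subst_s_single: "subst_s c (Poly_Mapping.single k a) = a * weyl_const (c ^ k)"
  by (simp add: subst_s_def)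

lemma subst_s_0 [simp]: "subst_s c 0 = 0"
  by (simp add: subst_s_def)

lemma subst_s_add: "subst_s c (P + Q) = subst_s c P + subst_s c Q"
  unfolding subst_s_def
  by (rule keys_sum_add[where g = "\<lambda>k a. a * weyl_const (c ^ k)"])
     (simp_all add: distrib_right)

text \<open>One step of the division by $s - c$: $a s^{k+1} = a s^k (s - c) + a c s^k$.\<close>

lemma single_Suc_eq:
  "Poly_Mapping.single (Suc k) a =
     Poly_Mapping.single k a * weyl_s_of_poly [:- c, 1:] + Poly_Mapping.single k (a * weyl_const c)"
proof -
  have "a * weyl_const (- c) + a * weyl_const c = 0"
    by (simp flip: distrib_left weyl_const_add)
  then show ?thesis
    by (simp add: weyl_s_of_poly_pCons distrib_left mult_single add.commute
        add.left_commute flip: single_add)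
qed

lemma subst_s_mult_linear: "subst_s c (Q * weyl_s_of_poly [:- c, 1:]) = 0"
proof (induction Q rule: pm_induct)
  case (add_single k a Q)
  have "subst_s c (Poly_Mapping.single (Suc k) a) =
      subst_s c (Poly_Mapping.single k a * weyl_s_of_poly [:- c, 1:]) +
      subst_s c (Poly_Mapping.single k (a * weyl_const c))"
    by (simp only: single_Suc_eq[of k a c] subst_s_add)
  then have "subst_s c (Poly_Mapping.single k a * weyl_s_of_poly [:- c, 1:]) = 0"
    by (simp add: subst_s_single weyl_const_mult mult.assoc)
  then show ?case using add_single by (simp add: distrib_right subst_s_add)
qed simp

text \<open>
  Division with remainder by the monic polynomial $s - c$, with coefficients in $D_n$; the
  remainder is the value at $c$.
\<close>

lemma weyl_s_division:
  "\<exists>Q. P = Poly_Mapping.single 0 (subst_s c P) + Q * weyl_s_of_poly [:- c, 1:]"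
proof (induction P rule: pm_induct)
  case zero
  show ?case by (rule exI[of _ 0]) simp
next
  case (add_single k a P)
  have "\<exists>Q. Poly_Mapping.single k a =
      Poly_Mapping.single 0 (a * weyl_const (c ^ k)) + Q * weyl_s_of_poly [:- c, 1:]"
  proof (induction k arbitrary: a)
    case 0
    show ?case by (rule exI[of _ 0]) simp
  next
    case (Suc k)
    obtain Q where Q: "Poly_Mapping.single k (a * weyl_const c) =
        Poly_Mapping.single 0 (a * weyl_const c * weyl_const (c ^ k)) + Q * weyl_s_of_poly [:- c, 1:]"
      using Suc by blast
    show ?case
      by (rule exI[of _ "Poly_Mapping.single k a + Q"])
         (simp add: single_Suc_eq[of k a c] Q weyl_const_mult distrib_right mult.assoc add_ac)
  qed
  then obtain Q where Q: "Poly_Mapping.single k a =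
      Poly_Mapping.single 0 (a * weyl_const (c ^ k)) + Q * weyl_s_of_poly [:- c, 1:]" by blast
  obtain Q' where Q': "P = Poly_Mapping.single 0 (subst_s c P) + Q' * weyl_s_of_poly [:- c, 1:]"
    using add_single by blast
  have "Poly_Mapping.single k a + P =
      (Poly_Mapping.single 0 (a * weyl_const (c ^ k)) + Q * weyl_s_of_poly [:- c, 1:]) +
      (Poly_Mapping.single 0 (subst_s c P) + Q' * weyl_s_of_poly [:- c, 1:])"
    using Q Q' by simp
  also have "\<dots> = Poly_Mapping.single 0 (subst_s c (Poly_Mapping.single k a + P)) +
      (Q + Q') * weyl_s_of_poly [:- c, 1:]"
    by (simp add: subst_s_add subst_s_single single_add distrib_right add_ac)
  finally show ?case by blast
qed

lemma subst_s_image_eq_UNIV_iff: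
  "J + left_ideal {weyl_s_of_poly [:- c, 1:]} = UNIV \<longleftrightarrow> subst_s c ` J = UNIV"
proof
  assume *: "J + left_ideal {weyl_s_of_poly [:- c, 1:]} = UNIV"
  have "a \<in> subst_s c ` J" for a
  proof -
    have "Poly_Mapping.single 0 a \<in> J + left_ideal {weyl_s_of_poly [:- c, 1:]}" using * by simp
    then obtain j Q where jQ: "j \<in> J" "Poly_Mapping.single 0 a = j + Q * weyl_s_of_poly [:- c, 1:]"
      unfolding left_ideal_singleton by (elim set_plus_elim) blast
    then have "subst_s c (Poly_Mapping.single 0 a) = subst_s c j"
      by (simp only: subst_s_add subst_s_mult_linear add_0_right)
    then show ?thesis using jQ(1) by (simp add: subst_s_single)
  qed
  then show "subst_s c ` J = UNIV" by blast
next
  assume *: "subst_s c ` J = UNIV"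
  have "P \<in> J + left_ideal {weyl_s_of_poly [:- c, 1:]}" for P
  proof -
    obtain j where j: "j \<in> J" "subst_s c j = subst_s c P" using * by (metis UNIV_I imageE)
    obtain Q where Q: "P = Poly_Mapping.single 0 (subst_s c P) + Q * weyl_s_of_poly [:- c, 1:]"
      using weyl_s_division by blast
    obtain Q' where Q': "j = Poly_Mapping.single 0 (subst_s c P) + Q' * weyl_s_of_poly [:- c, 1:]"
      using weyl_s_division[of j c] j(2) by auto
    have "P - j = (Q - Q') * weyl_s_of_poly [:- c, 1:]"
      using Q Q' by (metis add_diff_cancel_left left_diff_distrib)
    then have "P = j + (Q - Q') * weyl_s_of_poly [:- c, 1:]" by (simp add: diff_eq_eq add.commute)
    then show ?thesis using j(1) unfolding left_ideal_singleton by (metis rangeI set_plus_intro)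
  qed
  then show "J + left_ideal {weyl_s_of_poly [:- c, 1:]} = UNIV" by blast
qed


section \<open>Multiplicities of roots of the Bernstein-Sato polynomial\<close>

lemma pcompose_power: "pcompose (p ^ k) r = pcompose p r ^ k"
  for p :: "'a::comm_semiring_1 poly"
  by (induction k) (simp_all add: pcompose_mult pcompose_1)

lemma order_pcompose_neg:
  fixes b :: "'k::field poly"
  assumes "b \<noteq> 0"
  shows "order a (pcompose b [:0, - 1:]) = order (- a) b"
proof -
  obtain q where q: "b = [:a, 1:] ^ order (- a) b * q" "poly q (- a) \<noteq> 0"
    using order_decomp[OF assms, of "- a"] by (auto simp: poly_eq_0_iff_dvd)
  let ?n = "order (- a) b" and ?q = "pcompose q [:0, - 1:]"
  have "pcompose [:a, 1:] [:0, - 1:] = - [:- a, 1:]" by (simp add: pcompose_pCons)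
  then have "pcompose b [:0, - 1:] = (- [:- a, 1:]) ^ ?n * ?q"
    by (subst q(1)) (simp only: pcompose_mult pcompose_power)
  also have "\<dots> = [:- a, 1:] ^ ?n * ((- 1) ^ ?n * ?q)"
    by (simp only: power_minus[of "[:- a, 1:]"] mult_ac)
  finally have eq: "pcompose b [:0, - 1:] = [:- a, 1:] ^ ?n * ((- 1) ^ ?n * ?q)" .
  have nz: "poly ((- 1) ^ ?n * ?q) a \<noteq> 0" using q(2) by (simp add: poly_pcompose poly_power)
  then have "(- 1) ^ ?n * ?q \<noteq> 0" by auto
  then show ?thesis
    unfolding eq using nz by (subst order_mult) (auto simp: order_power_n_n order_0I)
qed

text \<open>
  The left-hand side is a statement about a noncommutative quotient, but both directions reduce
  to divisibility in $\mathbb{K}[s]$: a certificate for the left-hand side is turned into an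
  element of $I \cap \mathbb{K}[s]$ by multiplying it with a central element, and a Bezout
  identity in $\mathbb{K}[s]$ provides such a certificate.
\<close>

theorem quotient_sum_eq_UNIV_iff_order_le:
  fixes f :: "('n::{finite,linorder}, 'k::field) mpol" and c :: 'k
  assumes b: "bernstein_sato_poly f b"
  defines "u \<equiv> weyl_s_of_poly [:- c, 1:]"
  shows "ideal_quotient (bs_ideal f) (u ^ i) + left_ideal {u} = UNIV \<longleftrightarrow> order c b \<le> i"
proof -
  let ?u = "[:- c, 1:]" and ?m = "order c b"
  have b0: "b \<noteq> 0" using b by (auto simp: bernstein_sato_poly_def)
  obtain q where q: "b = ?u ^ ?m * q" "poly q c \<noteq> 0"
    using order_decomp[OF b0, of c] by (auto simp: poly_eq_0_iff_dvd)
  have bI: "weyl_s_of_poly b \<in> bs_ideal f"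
    using b by (simp add: weyl_s_of_poly_in_bs_ideal_iff bernstein_sato_poly_def)
  show ?thesis
  proof
    assume "?m \<le> i"
    then have "?u ^ i * q = ?u ^ (i - ?m) * b"
      by (subst q(1)) (simp add: mult.assoc[symmetric] power_add[symmetric] del: mult_pCons_left)
    then have *: "u ^ i * weyl_s_of_poly q \<in> bs_ideal f"
      unfolding u_def weyl_s_of_poly_power[symmetric] weyl_s_of_poly_mult[symmetric]
      using bs_ideal_lmult[OF bI] by (simp add: weyl_s_of_poly_mult)
    have qI: "u ^ i * (R * weyl_s_of_poly q) \<in> bs_ideal f" for R
    proof -
      have "u ^ i * (R * weyl_s_of_poly q) = R * (u ^ i * weyl_s_of_poly q)"
        by (simp only: u_def weyl_s_of_poly_power[symmetric] weyl_s_of_poly_commute[of _ R]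
            mult.assoc[symmetric])
      then show ?thesis using bs_ideal_lmult[OF *] by simp
    qed
    \<comment> \<open>Bezout for $q$ and $s - c$: subtract the value $q(c)$ and divide by it.\<close>
    obtain r where r: "q - [:poly q c:] = ?u * r"
      using poly_eq_0_iff_dvd[of "q - [:poly q c:]" c] by (auto elim: dvdE)
    have "1 = [:1 / poly q c:] * q + (- ([:1 / poly q c:] * r)) * ?u"
    proof -
      have "[:1 / poly q c:] * q - [:1 / poly q c:] * (?u * r) = [:1 / poly q c:] * [:poly q c:]"
        by (simp only: r[symmetric] right_diff_distrib) algebra
      also have "\<dots> = 1" using q(2) by (simp add: one_pCons)
      finally show ?thesis by algebra
    qed
    from arg_cong[OF this, of weyl_s_of_poly]
    obtain S T where ST: "1 = S * weyl_s_of_poly q + T * u"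
      unfolding u_def weyl_s_of_poly_add weyl_s_of_poly_mult weyl_s_of_poly_1 by blast
    have "P \<in> ideal_quotient (bs_ideal f) (u ^ i) + left_ideal {u}" for P
    proof -
      have "P = P * (S * weyl_s_of_poly q + T * u)" unfolding ST[symmetric] by simp
      also have "\<dots> = (P * S) * weyl_s_of_poly q + (P * T) * u"
        by (simp add: distrib_left mult.assoc)
      finally have "P = (P * S) * weyl_s_of_poly q + (P * T) * u" .
      moreover have "(P * S) * weyl_s_of_poly q \<in> ideal_quotient (bs_ideal f) (u ^ i)"
        by (simp add: ideal_quotient_def qI)
      ultimately show ?thesis unfolding left_ideal_singleton by (metis rangeI set_plus_intro)
    qed
    then show "ideal_quotient (bs_ideal f) (u ^ i) + left_ideal {u} = UNIV" by blast
  next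
    assume UNIV: "ideal_quotient (bs_ideal f) (u ^ i) + left_ideal {u} = UNIV"
    have "1 \<in> ideal_quotient (bs_ideal f) (u ^ i) + left_ideal {u}" unfolding UNIV by simp
    then obtain j Q where j: "u ^ i * j \<in> bs_ideal f" and one: "1 = j + Q * u"
      unfolding left_ideal_singleton ideal_quotient_def by (elim set_plus_elim) blast
    show "?m \<le> i"
    proof (rule ccontr)
      assume "\<not> ?m \<le> i"
      then obtain k where k: "?m = Suc (k + i)" by (metis add.commute less_imp_Suc_add not_le)
      \<comment> \<open>$g = b / (s - c)$ has too small a degree to lie in $I$.\<close>
      define g where "g = ?u ^ (k + i) * q"
      have bg: "b = ?u * g" using q(1) by (simp only: g_def k power_Suc mult.assoc)
      have g0: "g \<noteq> 0" using b0 bg by auto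
      have "weyl_s_of_poly g * j = weyl_s_of_poly (?u ^ k * q) * (u ^ i * j)"
        unfolding u_def weyl_s_of_poly_power[symmetric] mult.assoc[symmetric]
          weyl_s_of_poly_mult[symmetric]
        by (simp add: g_def power_add mult_ac)
      then have 1: "weyl_s_of_poly g * j \<in> bs_ideal f" using bs_ideal_lmult[OF j] by simp
      have "weyl_s_of_poly g * (Q * u) = Q * (weyl_s_of_poly g * u)"
        by (simp only: weyl_s_of_poly_commute[of g Q] mult.assoc[symmetric])
      also have "\<dots> = Q * weyl_s_of_poly b"
        by (simp only: u_def bg weyl_s_of_poly_mult[symmetric] mult.commute[of g])
      finally have "weyl_s_of_poly g * (Q * u) = Q * weyl_s_of_poly b" .
      then have 2: "weyl_s_of_poly g * (Q * u) \<in> bs_ideal f" using bs_ideal_lmult[OF bI] by simp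
      have "weyl_s_of_poly g = weyl_s_of_poly g * j + weyl_s_of_poly g * (Q * u)"
        using arg_cong[OF one, of "\<lambda>P. weyl_s_of_poly g * P"] by (simp add: distrib_left)
      then have "weyl_s_of_poly g \<in> bs_ideal f" using bs_ideal_add[OF 1 2] by simp
      then have "degree b \<le> degree g" using b g0 by (intro bernstein_sato_poly_degree_le)
      moreover have "degree b = Suc (degree g)"
        unfolding bg using g0 by (subst degree_mult_eq) simp_all
      ultimately show False by simp
    qed
  qed
qed


section \<open>The criterion for the multiplicity of a root\<close>

theorem corollary2p6:
  fixes f :: "('n::{finite,linorder}, 'k::field_char_0) mpol"
    and b :: "'k poly" and \<alpha> :: rat and i :: nat
  assumes "f \<noteq> 0"
    and "bernstein_sato_poly f b"
    and "\<alpha> > 0"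
  shows
    "(order (of_rat \<alpha>) (pcompose b [:0, - 1:]) > i \<longleftrightarrow>
       ideal_quotient (bs_ideal f) (weyl_s_of_poly [:of_rat \<alpha>, 1:] ^ i)
         + left_ideal {weyl_s_of_poly [:of_rat \<alpha>, 1:]} \<noteq> UNIV)
     \<and>
     (ideal_quotient (bs_ideal f) (weyl_s_of_poly [:of_rat \<alpha>, 1:] ^ i)
         + left_ideal {weyl_s_of_poly [:of_rat \<alpha>, 1:]} \<noteq> UNIV \<longleftrightarrow>
       subst_s (- of_rat \<alpha>) ` ideal_quotient (bs_ideal f) (weyl_s_of_poly [:of_rat \<alpha>, 1:] ^ i)
         \<noteq> UNIV)"
proof -
  have "b \<noteq> 0" using assms(2) by (auto simp: bernstein_sato_poly_def)
  then have "order (of_rat \<alpha>) (pcompose b [:0, - 1:]) = order (- of_rat \<alpha>) b"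
    by (rule order_pcompose_neg)
  then show ?thesis
    using quotient_sum_eq_UNIV_iff_order_le[OF assms(2), of "- of_rat \<alpha>" i]
      subst_s_image_eq_UNIV_iff[of
        "ideal_quotient (bs_ideal f) (weyl_s_of_poly [:of_rat \<alpha>, 1:] ^ i)" "- of_rat \<alpha>"]
    by (simp add: not_le[symmetric])
qed

end
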